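(* Let $\mathcal G=(\mathcal V,\mathcal E)$ be a weakly connected directed multigraph with node-link incidence matrix $A$, let $w\in\mathbb R^{\mathcal E}_{>0}$ be link weights, and let $p\in\mathbb R^{\mathcal V}$ be a supply-demand vector with $\mathbf 1^{\mathrm T}p=0$. Then the flow-weight Jacobian $J(w)=\left[\frac{\partial f(w,p)}{\partial w}\right]\in\mathbb R^{\mathcal E\times\mathcal E}$ (with entries $J_{ki}(w)=\partial f_k/\partial w_i$) is given by $$J(w)=(I-WA^{\mathrm T}L^\dagger A)\,\mathrm{diag}(A^{\mathrm T}L^\dagger p).$$
   Context: Multigraphs are finite, with parallel links allowed and no self-loops. Link $i$ goes from tail $\sigma(i)$ to head $\tau(i)$; $A\in\{-1,0,1\}^{\mathcal V\times\mathcal E}$ has $A_{vi}=1$ if $v=\sigma(i)$, $-1$ if $v=\tau(i)$, $0$ otherwise. $W=\mathrm{diag}(w)$, $L=L(w)=AWA^{\mathrm T}$ is the weighted Laplacian, and $L^\dagger$ is its Moore–Penrose pseudoinverse. The flow function is $f(w,p)=WA^{\mathrm T}L^\dagger p$, the unique $f$ with $Af=p$ and $f=WA^{\mathrm T}\phi$ for some $\phi\in\mathbb R^{\mathcal V}$. For a vector $a$, $\mathrm{diag}(a)$ is the diagonal matrix with diagonal $a$; $I$ is the identity matrix. *)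

theory Defs
  imports "HOL-Analysis.Analysis" "Graph_Theory.Digraph_Component"
begin

text \<open>
  Graphs are multi-digraphs with vertex type \<open>'v\<close> and link type \<open>'e\<close>, where
  \<open>tail\<close> and \<open>head\<close> are the maps \<open>\<sigma>\<close> and \<open>\<tau>\<close>. The matrices below are indexed by
  all of \<open>'v\<close> and \<open>'e\<close>, so they are meant for graphs with \<open>verts G = UNIV\<close> and
  \<open>arcs G = UNIV\<close>. A matrix with rows in \<open>'v\<close> and columns in \<open>'e\<close> has type
  \<open>real ^ 'e ^ 'v\<close>.
\<close>

definition incidence_matrix :: "('v::finite, 'e::finite) pre_digraph \<Rightarrow> real ^ 'e ^ 'v" where
  "incidence_matrix G =
    (\<chi> v i. if v = tail G i then 1 else if v = head G i then - 1 else 0)"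

definition diag_matrix :: "real ^ 'n \<Rightarrow> real ^ 'n ^ 'n::finite" where
  "diag_matrix a = (\<chi> i j. if i = j then a $ i else 0)"

definition weighted_laplacian ::
    "('v::finite, 'e::finite) pre_digraph \<Rightarrow> real ^ 'e \<Rightarrow> real ^ 'v ^ 'v" where
  "weighted_laplacian G w =
    incidence_matrix G ** diag_matrix w ** transpose (incidence_matrix G)"

text \<open>The four Penrose conditions, which determine the pseudoinverse uniquely.\<close>

definition is_pseudoinverse :: "real ^ 'n ^ 'm \<Rightarrow> real ^ 'm ^ 'n \<Rightarrow> bool" where
  "is_pseudoinverse M X \<longleftrightarrow>
    M ** X ** M = M \<and> X ** M ** X = X \<and>
    transpose (M ** X) = M ** X \<and> transpose (X ** M) = X ** M"

definition pseudoinverse :: "real ^ 'n ^ 'm \<Rightarrow> real ^ 'm ^ 'n" where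
  "pseudoinverse M = (THE X. is_pseudoinverse M X)"

definition flow ::
    "('v::finite, 'e::finite) pre_digraph \<Rightarrow> real ^ 'e \<Rightarrow> real ^ 'v \<Rightarrow> real ^ 'e" where
  "flow G w p =
    (diag_matrix w ** transpose (incidence_matrix G) ** pseudoinverse (weighted_laplacian G w)) *v p"

text \<open>
  Row \<open>k\<close>, column \<open>i\<close> is the partial derivative of \<open>f\<^sub>k\<close> with respect to \<open>w\<^sub>i\<close>.
  The operator \<open>deriv\<close> is total, so existence of the derivatives has to be stated separately.
\<close>

definition flow_weight_jacobian ::
    "('v::finite, 'e::finite) pre_digraph \<Rightarrow> real ^ 'v \<Rightarrow> real ^ 'e \<Rightarrow> real ^ 'e ^ 'e" where
  "flow_weight_jacobian G p w =
    (\<chi> k i. deriv (\<lambda>t. flow G (\<chi> j. if j = i then t else w $ j) p $ k) (w $ i))"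

lemma flow_weight_jacobian_eq_jacobian:
  assumes "(\<lambda>u. flow G u p) differentiable (at w)"
  shows "flow_weight_jacobian G p w = jacobian (\<lambda>u. flow G u p) (at w)"
proof -
  let ?J = "jacobian (\<lambda>u. flow G u p) (at w)"
  have "deriv (\<lambda>t. flow G (\<chi> j. if j = i then t else w $ j) p $ k) (w $ i) = ?J $ k $ i" for k i
  proof -
    define g where "g = (\<lambda>t. \<chi> j. if j = i then t else w $ j)"
    have g_eq: "g = (\<lambda>t. w + (t - w $ i) *\<^sub>R axis i 1)"
      by (auto simp: g_def axis_def vec_eq_iff)
    have g: "(g has_derivative (\<lambda>h. h *\<^sub>R axis i 1)) (at (w $ i))"
      unfolding g_eq by (auto intro!: derivative_eq_intros)
    have "g (w $ i) = w"
      by (simp add: g_eq)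
    then have "((\<lambda>u. flow G u p) has_derivative (\<lambda>h. ?J *v h)) (at (g (w $ i)))"
      using assms jacobian_works by metis
    from has_derivative_compose[OF g this]
    have "((\<lambda>t. flow G (g t) p $ k) has_derivative (\<lambda>h. (?J *v (h *\<^sub>R axis i 1)) $ k)) (at (w $ i))"
      by (rule bounded_linear.has_derivative[OF bounded_linear_vec_nth])
    moreover have "(?J *v (h *\<^sub>R axis i 1)) $ k = ?J $ k $ i * h" for h
      by (simp add: matrix_vector_mult_scaleR matrix_vector_mult_basis column_def)
    ultimately have "((\<lambda>t. flow G (g t) p $ k) has_real_derivative ?J $ k $ i) (at (w $ i))"
      by (simp add: has_field_derivative_def)
    then show ?thesis
      unfolding g_def by (rule DERIV_imp_deriv)
  qed
  then show ?thesis
    by (simp add: flow_weight_jacobian_def vec_eq_iff)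
qed

end

theory Submission
  imports Defs
begin

text \<open>
  The flow map depends on the weights through the pseudoinverse \<open>L\<^sup>\<dagger>\<close> of
  the Laplacian \<open>L(u) = A diag(u) A\<^sup>T\<close>. The point of the proof is that this
  dependence can be described by an exact difference formula, so that a derivative is
  obtained from mere continuity of the pseudoinverse.

  For positive weights \<open>u\<close> the kernel of \<open>L(u)\<close> is that of \<open>A\<^sup>T\<close>, by positivity of
  the energy \<open>x\<^sup>T L(u) x = \<Sum>\<^sub>i u\<^sub>i (A\<^sup>T x)\<^sub>i\<^sup>2\<close>. In a connected graph this kernel
  consists of the constant vectors, and \<open>P = (1/n) 1 1\<^sup>T\<close> is the orthogonal projector onto
  it (\<open>transpose_kernel_projector_incidence\<close>). The kernel is the same for all positive weights.
  Hence \<open>L(u) + P\<close> is invertible, and \<open>L(u)\<^sup>\<dagger> = (L(u) + P)\<^sup>-\<^sup>1 - P\<close> satisfies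
  \<open>L L\<^sup>\<dagger> = L\<^sup>\<dagger> L = I - P\<close> with a right-hand side that does not change with \<open>u\<close>
  (\<open>L_L_dag\<close>, \<open>L_dag_L\<close>). This gives a resolvent identity
  \<open>L(u)\<^sup>\<dagger> - L(w)\<^sup>\<dagger> = - L(u)\<^sup>\<dagger> (L(u) - L(w)) L(w)\<^sup>\<dagger>\<close> (\<open>L_dag_diff\<close>).
  Since \<open>L(u) - L(w) = A diag(u - w) A\<^sup>T\<close>, the product rule for differences yields
  \<open>f(u) - f(w) = (I - diag(u) A\<^sup>T L(u)\<^sup>\<dagger> A) diag(A\<^sup>T L(w)\<^sup>\<dagger> p) (u - w)\<close>,
  in which the last two factors may be written in this order because
  \<open>diag(a) b = diag(b) a\<close> (\<open>flow_map_diff\<close>).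

  The matrix in front of \<open>u - w\<close> is continuous in \<open>u\<close>, as Cramer's rule makes matrix
  inversion continuous (\<open>isCont_matrix_inv\<close>). By Caratheodory's characterisation of
  differentiability (\<open>has_derivative_Caratheodory_matrix\<close>) its value at \<open>u = w\<close> is the
  Jacobian.
\<close>

section \<open>Matrix preliminaries\<close>

lemma matrix_diff_ldistrib: "A ** (B - C) = A ** B - A ** (C :: real ^ 'n ^ 'm)"
  by (vector matrix_matrix_mult_def sum_subtractf[symmetric] right_diff_distrib)

lemma matrix_diff_rdistrib: "(B - C) ** A = B ** A - (C :: real ^ 'm ^ 'k) ** A"
  by (vector matrix_matrix_mult_def sum_subtractf[symmetric] left_diff_distrib)

lemma matrix_mul_zero_left [simp]: "0 ** A = (0 :: real ^ 'n ^ 'm)"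
  by (vector matrix_matrix_mult_def)

lemma matrix_mul_zero_right [simp]: "A ** 0 = (0 :: real ^ 'n ^ 'm)"
  by (vector matrix_matrix_mult_def)

lemma matrix_add_rdistrib: "(B + C) ** A = B ** A + (C :: real ^ 'm ^ 'k) ** A"
  by (vector matrix_matrix_mult_def sum.distrib[symmetric] distrib_right)

lemma transpose_diff: "transpose (A - B) = transpose A - transpose (B :: real ^ 'n ^ 'm)"
  by (vector transpose_def)

lemma inner_matrix_transpose:
  fixes A :: "real ^ 'n ^ 'm"
  shows "x \<bullet> (A *v y) = (transpose A *v x) \<bullet> y"
  by (simp add: dot_lmul_matrix)

lemma transpose_diag_matrix [simp]: "transpose (diag_matrix a) = diag_matrix a"
  by (simp add: diag_matrix_def transpose_def vec_eq_iff)

lemma diag_matrix_diff: "diag_matrix (a - b) = diag_matrix a - diag_matrix b"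
  by (simp add: diag_matrix_def vec_eq_iff)

lemma diag_matrix_mult_vector_nth [simp]: "(diag_matrix a *v x) $ i = a $ i * x $ i"
  by (simp add: diag_matrix_def matrix_vector_mult_def if_distrib[of "\<lambda>z. z * _"] cong: if_cong)

lemma diag_matrix_mult_vector_commute: "diag_matrix a *v x = diag_matrix x *v a"
  by (simp add: vec_eq_iff)

lemma isCont_matrix:
  fixes M :: "'a::t2_space \<Rightarrow> real ^ 'n ^ 'm"
  assumes "\<And>k i. isCont (\<lambda>u. M u $ k $ i) w"
  shows "isCont M w"
proof -
  have "isCont (\<lambda>u. \<chi> k i. M u $ k $ i) w"
    using assms unfolding isCont_def by (intro tendsto_vec_lambda) simp
  then show ?thesis by simp
qed

lemma isCont_matrix_mult:
  fixes M :: "'a::t2_space \<Rightarrow> real ^ 'n ^ 'm" and N :: "'a \<Rightarrow> real ^ 'k ^ 'n"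
  assumes "isCont M w" "isCont N w"
  shows "isCont (\<lambda>u. M u ** N u) w"
  by (rule isCont_matrix) (use assms in \<open>auto simp: matrix_matrix_mult_def intro!: continuous_intros\<close>)

lemma isCont_diag_matrix: "isCont diag_matrix w"
proof (rule isCont_matrix)
  show "isCont (\<lambda>u. diag_matrix u $ k $ i) w" for k i
    by (cases "k = i") (simp_all add: diag_matrix_def)
qed

lemma isCont_det:
  fixes M :: "'a::t2_space \<Rightarrow> real ^ 'n ^ 'n"
  assumes "isCont M w"
  shows "isCont (\<lambda>u. det (M u)) w"
  unfolding det_def using assms by (intro continuous_intros)

lemma matrix_inv_inverse:
  fixes K :: "real ^ 'n ^ 'n"
  assumes "invertible K"
  shows "K ** matrix_inv K = mat 1" "matrix_inv K ** K = mat 1"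
proof -
  have "\<exists>K'. K ** K' = mat 1 \<and> K' ** K = mat 1"
    using assms by (simp add: invertible_def)
  then have "K ** matrix_inv K = mat 1 \<and> matrix_inv K ** K = mat 1"
    unfolding matrix_inv_def by (rule someI_ex)
  then show "K ** matrix_inv K = mat 1" "matrix_inv K ** K = mat 1" by auto
qed

text \<open>
  By Cramer's rule each entry of the inverse is a quotient of determinants, which are
  polynomials in the entries of the matrix.
\<close>

lemma isCont_matrix_inv:
  fixes K :: "'a::t2_space \<Rightarrow> real ^ 'n ^ 'n"
  assumes K: "isCont K w" and inv: "invertible (K w)"
  shows "isCont (\<lambda>u. matrix_inv (K u)) w"
proof (rule isCont_matrix)
  fix k l
  \<comment> \<open>The entry in row \<open>k\<close> and column \<open>l\<close> of the inverse is the \<open>k\<close>-th unknown of the linear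
      system with the unit vector \<open>axis l 1\<close> on the right-hand side.\<close>
  define C where "C = (\<lambda>u. det (\<chi> i j. if j = k then axis l 1 $ i else K u $ i $ j) / det (K u))"
  have entry: "isCont (\<lambda>u. K u $ i $ j) w" for i j
    using K by simp
  have det_cont: "isCont (\<lambda>u. det (K u)) w"
    using K by (rule isCont_det)
  have det_nz: "det (K w) \<noteq> 0"
    using inv by (simp add: invertible_det_nz)
  have "isCont (\<lambda>u. if j = k then axis l 1 $ i else K u $ i $ j) w" for i j
    using entry by (cases "j = k") simp_all
  then have "isCont (\<lambda>u. det (\<chi> i j. if j = k then axis l 1 $ i else K u $ i $ j)) w"
    by (intro isCont_det isCont_matrix) simp
  then have "isCont C w"
    unfolding C_def using det_cont det_nz by (intro continuous_intros)
  moreover have "\<forall>\<^sub>F u in nhds w. matrix_inv (K u) $ k $ l = C u"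
  proof -
    have "\<forall>\<^sub>F u in at w. det (K u) \<noteq> 0"
      using det_cont det_nz unfolding isCont_def by (rule tendsto_imp_eventually_ne)
    then have "\<forall>\<^sub>F u in nhds w. det (K u) \<noteq> 0"
      using det_nz by (simp add: eventually_nhds_conv_at)
    then show ?thesis
    proof eventually_elim
      case (elim u)
      then have "K u ** matrix_inv (K u) = mat 1"
        by (simp add: matrix_inv_inverse invertible_det_nz)
      then have "K u *v (matrix_inv (K u) *v axis l 1) = axis l 1"
        by (simp add: matrix_vector_mul_assoc)
      then have "matrix_inv (K u) *v axis l 1 =
          (\<chi> k. det (\<chi> i j. if j = k then axis l 1 $ i else K u $ i $ j) / det (K u))"
        using cramer[OF elim] by blast
      then have "(matrix_inv (K u) *v axis l 1) $ k = C u"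
        by (simp add: C_def)
      then show ?case
        by (simp add: matrix_vector_mult_basis column_def)
    qed
  qed
  ultimately show "isCont (\<lambda>u. matrix_inv (K u) $ k $ l) w"
    using isCont_cong by fast
qed

lemma eventually_positive:
  fixes w :: "real ^ 'n"
  assumes "\<And>i. 0 < w $ i"
  shows "\<forall>\<^sub>F u in nhds w. \<forall>i. 0 < u $ i"
proof -
  have "\<forall>\<^sub>F u in nhds w. 0 < u $ i" for i
    by (rule order_tendstoD(1)[OF tendsto_vec_nth[OF filterlim_ident] assms])
  then show ?thesis
    by (rule eventually_all_finite)
qed

text \<open>
  Caratheodory's criterion: a slope matrix \<open>M u\<close> that represents the increment exactly and is
  continuous at the base point gives the derivative, because the error
  \<open>(M u - M w) (u - w)\<close> is \<open>o(u - w)\<close>.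
\<close>

lemma has_derivative_Caratheodory_matrix:
  fixes f :: "real ^ 'n \<Rightarrow> real ^ 'm" and M :: "real ^ 'n \<Rightarrow> real ^ 'n ^ 'm"
  assumes M: "isCont M w"
    and f: "\<forall>\<^sub>F u in nhds w. f u - f w = M u *v (u - w)"
  shows "(f has_derivative (*v) (M w)) (at w)"
proof -
  define H where "H = (\<lambda>u. \<Sum>k\<in>UNIV. \<Sum>i\<in>UNIV. \<bar>(M u - M w) $ k $ i\<bar>)"
  obtain e where e: "0 < e" "\<And>u. dist u w < e \<Longrightarrow> f u - f w = M u *v (u - w)"
    using f unfolding eventually_nhds_metric by blast
  show ?thesis
  proof (rule has_derivativeI_sandwich[OF e(1), where H = H])
    show "bounded_linear ((*v) (M w))" by simp
    have "isCont H w"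
      unfolding H_def using M by (intro continuous_intros) auto
    moreover have "H w = 0" by (simp add: H_def)
    ultimately show "(H \<longlongrightarrow> 0) (at w)"
      by (metis isCont_def)
    fix u assume "u \<noteq> w" "dist u w < e"
    have "norm (f u - f w - M w *v (u - w)) = norm ((M u - M w) *v (u - w))"
      using e(2)[OF \<open>dist u w < e\<close>] by (simp add: matrix_vector_mult_diff_rdistrib)
    also have "\<dots> \<le> onorm ((*v) (M u - M w)) * norm (u - w)"
      by (rule onorm) simp
    also have "\<dots> \<le> H u * norm (u - w)"
      unfolding H_def by (intro mult_right_mono onorm_le_matrix_component_sum) simp
    finally show "norm (f u - f w - M w *v (u - w)) / norm (u - w) \<le> H u"
      using \<open>u \<noteq> w\<close> by (simp add: divide_le_eq)
  qed
qed

section \<open>The pseudoinverse\<close>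

text \<open>
  Both \<open>M X\<close> and \<open>M Y\<close> are the orthogonal projector onto the range of \<open>M\<close>, and dually for
  \<open>X M\<close> and \<open>Y M\<close>; then \<open>X = X M X = Y M Y = Y\<close>.
\<close>

lemma is_pseudoinverse_unique:
  assumes X: "is_pseudoinverse M X" and Y: "is_pseudoinverse M Y"
  shows "X = Y"
proof -
  have MX: "M ** X = M ** Y"
  proof -
    have "M ** X = transpose (M ** Y ** M ** X)"
      using X Y by (simp add: is_pseudoinverse_def)
    also have "\<dots> = transpose (M ** X) ** transpose (M ** Y)"
      by (simp add: matrix_transpose_mul[symmetric] matrix_mul_assoc)
    also have "\<dots> = M ** X ** M ** Y"
      using X Y by (simp add: is_pseudoinverse_def matrix_mul_assoc)
    finally show ?thesis
      using X by (simp add: is_pseudoinverse_def)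
  qed
  have XM: "X ** M = Y ** M"
  proof -
    have "X ** M = transpose (X ** M ** Y ** M)"
      using X Y by (simp add: is_pseudoinverse_def matrix_mul_assoc[symmetric])
    also have "\<dots> = transpose (Y ** M) ** transpose (X ** M)"
      by (simp add: matrix_transpose_mul[symmetric] matrix_mul_assoc)
    also have "\<dots> = Y ** M ** (X ** M)"
      using X Y by (simp add: is_pseudoinverse_def)
    also have "\<dots> = Y ** (M ** X ** M)"
      by (simp only: matrix_mul_assoc)
    finally show ?thesis
      using X by (simp add: is_pseudoinverse_def)
  qed
  have "X = X ** M ** X"
    using X by (simp add: is_pseudoinverse_def)
  also have "\<dots> = Y ** M ** Y"
    using MX XM by (metis matrix_mul_assoc)
  also have "\<dots> = Y"
    using Y by (simp add: is_pseudoinverse_def)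
  finally show ?thesis .
qed

lemma pseudoinverse_eqI: "is_pseudoinverse M X \<Longrightarrow> pseudoinverse M = X"
  unfolding pseudoinverse_def by (blast intro: is_pseudoinverse_unique)

section \<open>Weighted Gram matrices with a fixed kernel\<close>

text \<open>
  The assumptions say that \<open>P\<close> is the orthogonal projector onto the kernel of
  \<open>A\<^sup>T\<close>. Connectedness of a graph enters only through the form of this kernel.
\<close>

locale transpose_kernel_projector =
  fixes A :: "real ^ 'e ^ 'v" and P :: "real ^ 'v ^ 'v"
  assumes P_sym: "transpose P = P"
    and transpose_A_P: "transpose A ** P = 0"
    and kernel_fixed: "\<And>x. transpose A *v x = 0 \<Longrightarrow> P *v x = x"
begin

definition L :: "real ^ 'e \<Rightarrow> real ^ 'v ^ 'v" where
  "L u = A ** diag_matrix u ** transpose A"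

text \<open>
  Adding \<open>P\<close> moves the kernel of \<open>L\<close> to eigenvalue 1 and leaves its complement alone, so
  that subtracting \<open>P\<close> after inversion leaves the pseudoinverse of \<open>L\<close>
  (\<open>pseudoinverse_L\<close>).
\<close>

definition L_dag :: "real ^ 'e \<Rightarrow> real ^ 'v ^ 'v" where
  "L_dag u = matrix_inv (L u + P) - P"

lemma P_A: "P ** A = 0"
proof -
  have "P ** A = transpose (transpose A ** P)"
    by (simp add: matrix_transpose_mul P_sym)
  also have "\<dots> = 0"
    unfolding transpose_A_P by (simp add: transpose_def vec_eq_iff)
  finally show ?thesis .
qed

lemma P_idem: "P ** P = P"
proof -
  have "(P ** P) *v x = P *v x" for x
  proof -
    have "transpose A *v (P *v x) = 0"
      by (simp only: matrix_vector_mul_assoc transpose_A_P matrix_vector_mult_0)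
    then show ?thesis
      using kernel_fixed matrix_vector_mul_assoc by metis
  qed
  then show ?thesis by (simp add: matrix_eq)
qed

lemma L_P: "L u ** P = 0"
  by (simp add: L_def matrix_mul_assoc[symmetric] transpose_A_P)

lemma P_L: "P ** L u = 0"
  by (simp add: L_def matrix_mul_assoc P_A)

lemma L_diff: "L u - L w = A ** diag_matrix (u - w) ** transpose A"
  by (simp add: L_def diag_matrix_diff matrix_diff_ldistrib matrix_diff_rdistrib)

text \<open>
  The quadratic form \<open>x\<^sup>T L x\<close> is a positively weighted sum of the squares of the
  entries of \<open>A\<^sup>T x\<close>.
\<close>

lemma L_kernel:
  assumes u: "\<And>i. 0 < u $ i" and x: "L u *v x = 0"
  shows "transpose A *v x = 0"
proof -
  define y where "y = transpose A *v x"
  have "0 = x \<bullet> (L u *v x)"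
    using x by simp
  also have "\<dots> = x \<bullet> (A *v (diag_matrix u *v y))"
    by (simp only: L_def y_def matrix_vector_mul_assoc matrix_mul_assoc)
  also have "\<dots> = y \<bullet> (diag_matrix u *v y)"
    by (simp only: inner_matrix_transpose y_def)
  also have "\<dots> = (\<Sum>i\<in>UNIV. u $ i * (y $ i)\<^sup>2)"
    by (simp add: inner_vec_def power2_eq_square mult_ac)
  finally have "(\<Sum>i\<in>UNIV. u $ i * (y $ i)\<^sup>2) = 0" by simp
  moreover have "0 \<le> u $ i * (y $ i)\<^sup>2" for i
    using u[of i] by simp
  ultimately have "u $ i * (y $ i)\<^sup>2 = 0" for i
    by (simp add: sum_nonneg_eq_0_iff)
  then have "y $ i = 0" for i
    using u by (metis less_irrefl mult_eq_0_iff power2_eq_square)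
  then show ?thesis
    unfolding y_def[symmetric] by (simp add: vec_eq_iff)
qed

lemma invertible_L_plus_P:
  assumes u: "\<And>i. 0 < u $ i"
  shows "invertible (L u + P)"
proof -
  have "x = 0" if x: "(L u + P) *v x = 0" for x
  proof -
    have "P *v x = (P ** (L u + P)) *v x"
      by (simp add: matrix_add_ldistrib P_L P_idem)
    also have "\<dots> = 0"
      using x by (simp add: matrix_vector_mul_assoc[symmetric])
    finally have Px: "P *v x = 0" .
    then have "L u *v x = 0"
      using x by (simp add: matrix_vector_mult_add_rdistrib)
    then show "x = 0"
      using kernel_fixed L_kernel[OF u] Px by metis
  qed
  then show ?thesis
    by (simp add: invertible_left_inverse matrix_left_invertible_ker)
qed

context
  fixes u :: "real ^ 'e"
  assumes u: "\<And>i. 0 < u $ i"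
begin

lemma P_L_dag: "P ** L_dag u = 0" and L_dag_P: "L_dag u ** P = 0"
proof -
  note inv = matrix_inv_inverse[OF invertible_L_plus_P[OF u]]
  have absorb: "P ** (L u + P) = P" "(L u + P) ** P = P"
    by (simp_all add: matrix_add_ldistrib matrix_add_rdistrib P_L L_P P_idem)
  have "P ** (L u + P) ** matrix_inv (L u + P) = P"
    by (simp only: matrix_mul_assoc[symmetric] inv matrix_mul_rid)
  moreover have "matrix_inv (L u + P) ** ((L u + P) ** P) = P"
    by (simp only: matrix_mul_assoc inv matrix_mul_lid)
  ultimately have "P ** matrix_inv (L u + P) = P" "matrix_inv (L u + P) ** P = P"
    by (simp_all only: absorb)
  then show "P ** L_dag u = 0" "L_dag u ** P = 0"
    by (simp_all add: L_dag_def matrix_diff_ldistrib matrix_diff_rdistrib P_idem)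
qed

lemma L_L_dag: "L u ** L_dag u = mat 1 - P" and L_dag_L: "L_dag u ** L u = mat 1 - P"
proof -
  note inv = matrix_inv_inverse[OF invertible_L_plus_P[OF u]]
  have inv_eq: "matrix_inv (L u + P) = L_dag u + P" by (simp add: L_dag_def)
  have "(L u + P) ** (L_dag u + P) = L u ** L_dag u + P"
    by (simp add: matrix_add_ldistrib matrix_add_rdistrib P_L_dag L_P P_idem)
  then show "L u ** L_dag u = mat 1 - P"
    using inv by (simp add: inv_eq eq_diff_eq)
  have "(L_dag u + P) ** (L u + P) = L_dag u ** L u + P"
    by (simp add: matrix_add_ldistrib matrix_add_rdistrib L_dag_P P_L P_idem)
  then show "L_dag u ** L u = mat 1 - P"
    using inv by (simp add: inv_eq eq_diff_eq)
qed

lemma pseudoinverse_L: "pseudoinverse (L u) = L_dag u"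
  by (rule pseudoinverse_eqI)
    (simp add: is_pseudoinverse_def L_L_dag L_dag_L matrix_diff_rdistrib P_L P_L_dag transpose_diff P_sym)

end

text \<open>
  A resolvent identity. It holds as for ordinary inverses because
  \<open>L(w) L(w)\<^sup>\<dagger>\<close> and \<open>L(u)\<^sup>\<dagger> L(u)\<close> are the same projector \<open>I - P\<close>, which
  \<open>L(u)\<^sup>\<dagger>\<close> and \<open>L(w)\<^sup>\<dagger>\<close> both absorb.
\<close>

lemma L_dag_diff:
  assumes u: "\<And>i. 0 < u $ i" and w: "\<And>i. 0 < w $ i"
  shows "L_dag u - L_dag w = - (L_dag u ** (L u - L w) ** L_dag w)"
proof -
  have "L_dag u = L_dag u ** (L w ** L_dag w)" "L_dag w = L_dag u ** L u ** L_dag w"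
    by (simp_all add: L_L_dag[OF w] L_dag_L[OF u] L_dag_P[OF u] P_L_dag[OF w]
        matrix_diff_ldistrib matrix_diff_rdistrib)
  then show ?thesis
    by (simp add: matrix_diff_ldistrib matrix_diff_rdistrib matrix_mul_assoc)
qed

lemma isCont_L_dag:
  assumes w: "\<And>i. 0 < w $ i"
  shows "isCont L_dag w"
proof -
  have "isCont (\<lambda>u. L u + P) w"
    unfolding L_def by (intro continuous_intros isCont_matrix_mult isCont_diag_matrix)
  then have "isCont (\<lambda>u. matrix_inv (L u + P)) w"
    using invertible_L_plus_P[OF w] by (rule isCont_matrix_inv)
  then have "isCont (\<lambda>u. matrix_inv (L u + P) - P) w"
    by (intro continuous_intros)
  then show ?thesis
    by (simp add: L_dag_def[abs_def])
qed

definition flow_map :: "real ^ 'e \<Rightarrow> real ^ 'v \<Rightarrow> real ^ 'e" where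
  "flow_map u p = (diag_matrix u ** transpose A ** L_dag u) *v p"

text \<open>
  The weights \<open>w\<close> enter through the fixed potential differences \<open>A\<^sup>T L(w)\<^sup>\<dagger> p\<close> and the
  varying weights \<open>u\<close> through the projector. At \<open>u = w\<close> this is the claimed Jacobian.
\<close>

definition flow_slope :: "real ^ 'v \<Rightarrow> real ^ 'e \<Rightarrow> real ^ 'e \<Rightarrow> real ^ 'e ^ 'e" where
  "flow_slope p w u = (mat 1 - diag_matrix u ** transpose A ** L_dag u ** A)
      ** diag_matrix ((transpose A ** L_dag w) *v p)"

text \<open>
  An identity without remainder: the increment of \<open>diag(u)\<close> and that of \<open>L(u)\<^sup>\<dagger>\<close>
  contribute the two terms of the first factor of the slope matrix.
\<close>

lemma flow_map_diff:
  assumes u: "\<And>i. 0 < u $ i" and w: "\<And>i. 0 < w $ i"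
  shows "flow_map u p - flow_map w p = flow_slope p w u *v (u - w)"
proof -
  let ?B = "transpose A" and ?D = "diag_matrix :: real ^ 'e \<Rightarrow> real ^ 'e ^ 'e"
  \<comment> \<open>Product rule for differences: change the weights first, then the pseudoinverse.\<close>
  have "?D u ** ?B ** L_dag u - ?D w ** ?B ** L_dag w
      = ?D (u - w) ** ?B ** L_dag w + ?D u ** ?B ** (L_dag u - L_dag w)"
    by (simp add: diag_matrix_diff matrix_diff_ldistrib matrix_diff_rdistrib)
  also have "\<dots> = ?D (u - w) ** ?B ** L_dag w - ?D u ** ?B ** L_dag u ** A ** ?D (u - w) ** ?B ** L_dag w"
  proof -
    have "L_dag u - L_dag w = 0 - L_dag u ** A ** ?D (u - w) ** ?B ** L_dag w"
      by (simp add: L_dag_diff[OF u w] L_diff matrix_mul_assoc)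
    then show ?thesis
      by (simp only: matrix_diff_ldistrib matrix_mul_assoc) simp
  qed
  also have "\<dots> = (mat 1 - ?D u ** ?B ** L_dag u ** A) ** ?D (u - w) ** (?B ** L_dag w)"
    by (simp add: matrix_diff_rdistrib matrix_mul_assoc)
  finally have eq: "?D u ** ?B ** L_dag u - ?D w ** ?B ** L_dag w
      = (mat 1 - ?D u ** ?B ** L_dag u ** A) ** ?D (u - w) ** (?B ** L_dag w)" .
  have "flow_map u p - flow_map w p = (?D u ** ?B ** L_dag u - ?D w ** ?B ** L_dag w) *v p"
    by (simp only: flow_map_def matrix_vector_mult_diff_rdistrib)
  also have "\<dots> = (mat 1 - ?D u ** ?B ** L_dag u ** A) *v (?D (u - w) *v ((?B ** L_dag w) *v p))"
    unfolding eq by (simp only: matrix_vector_mul_assoc matrix_mul_assoc)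
  also have "?D (u - w) *v ((?B ** L_dag w) *v p) = ?D ((?B ** L_dag w) *v p) *v (u - w)"
    by (rule diag_matrix_mult_vector_commute)
  finally show ?thesis
    by (simp only: flow_slope_def matrix_vector_mul_assoc)
qed

lemma flow_map_has_derivative:
  assumes w: "\<And>i. 0 < w $ i"
  shows "((\<lambda>u. flow_map u p) has_derivative (*v) (flow_slope p w w)) (at w)"
proof (rule has_derivative_Caratheodory_matrix[where M = "flow_slope p w"])
  show "isCont (flow_slope p w) w"
    unfolding flow_slope_def[abs_def]
    by (intro continuous_intros isCont_matrix_mult isCont_diag_matrix isCont_L_dag[OF w])
  show "\<forall>\<^sub>F u in nhds w. flow_map u p - flow_map w p = flow_slope p w u *v (u - w)"
    using eventually_positive[OF w] by eventually_elim (simp add: flow_map_diff w)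
qed

end

section \<open>Incidence matrices of connected graphs\<close>

text \<open>
  The orthogonal projector onto the constant vectors.
\<close>

definition mean_matrix :: "real ^ 'v ^ 'v::finite" where
  "mean_matrix = (\<chi> i j. 1 / real CARD('v))"

lemma mean_matrix_mult_vector: "mean_matrix *v x = (\<chi> v. (\<Sum>a\<in>UNIV. x $ a) / real CARD('v))"
  for x :: "real ^ 'v::finite"
  by (simp add: mean_matrix_def matrix_vector_mult_def vec_eq_iff sum_divide_distrib)

lemma transpose_incidence_matrix_mult_nth:
  assumes "tail G i \<noteq> head G i"
  shows "(transpose (incidence_matrix G) *v x) $ i = x $ tail G i - x $ head G i"
proof -
  have "(transpose (incidence_matrix G) *v x) $ i =
    (\<Sum>v\<in>UNIV. (if v = tail G i then x $ v else 0) - (if v = head G i then x $ v else 0))"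
    using assms
    by (auto simp: incidence_matrix_def transpose_def matrix_vector_mult_def
        simp del: transpose_matrix_vector intro!: sum.cong)
  then show ?thesis
    by (simp add: sum_subtractf)
qed

text \<open>
  The value is preserved along each step of a walk in the symmetric closure of the graph.
\<close>

lemma connected_imp_constant:
  assumes G: "Digraph_Component.connected G"
    and x: "\<And>e. e \<in> arcs G \<Longrightarrow> x (tail G e) = x (head G e)"
    and "a \<in> verts G" "b \<in> verts G"
  shows "x a = x b"
proof -
  have "a \<rightarrow>\<^sup>*\<^bsub>mk_symmetric G\<^esub> b"
    using G assms(3,4) by (auto simp: connected_def strongly_connected_def)
  then have "(a, b) \<in> rtrancl_on (pverts (mk_symmetric G)) (parcs (mk_symmetric G))"
    by (simp add: reachable_def)
  then show ?thesis
    by (induction rule: rtrancl_on_induct) (auto simp: parcs_mk_symmetric x)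
qed

lemma transpose_kernel_projector_incidence:
  fixes G :: "('v::finite, 'e::finite) pre_digraph"
  assumes "loopfree_digraph G" "verts G = UNIV" "arcs G = UNIV" "Digraph_Component.connected G"
  shows "transpose_kernel_projector (incidence_matrix G) mean_matrix"
proof
  have noloop: "tail G i \<noteq> head G i" for i
    using loopfree_digraph.no_loops[OF assms(1)] assms(3) by simp
  note AT = transpose_incidence_matrix_mult_nth[OF noloop]
  show "transpose mean_matrix = (mean_matrix :: real ^ 'v ^ 'v)"
    by (simp add: mean_matrix_def transpose_def)
  show "transpose (incidence_matrix G) ** mean_matrix = 0"
  proof -
    have "transpose (incidence_matrix G) *v (mean_matrix *v x) = 0" for x
      by (simp add: vec_eq_iff AT mean_matrix_mult_vector del: transpose_matrix_vector)
    then have "(transpose (incidence_matrix G) ** mean_matrix) *v x = 0 *v x" for x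
      by (simp only: matrix_vector_mul_assoc matrix_vector_mult_0)
    then show ?thesis
      unfolding matrix_eq by blast
  qed
  show "mean_matrix *v x = x" if "transpose (incidence_matrix G) *v x = 0" for x
  proof -
    have edge: "x $ tail G i = x $ head G i" for i
      using that AT[of x i] by (simp del: transpose_matrix_vector)
    have const: "x $ a = x $ b" for a b
      by (rule connected_imp_constant[OF assms(4)]) (simp_all add: edge assms(2))
    show ?thesis
    proof (rule vec_eq_iff[THEN iffD2, rule_format])
      fix b
      have "(\<Sum>a\<in>UNIV. x $ a) = (\<Sum>a\<in>(UNIV :: 'v set). x $ b)"
        by (rule sum.cong[OF refl const])
      then show "(mean_matrix *v x) $ b = x $ b"
        by (simp add: mean_matrix_mult_vector)
    qed
  qed
qed

theorem proposition3:
  fixes G :: "('v::finite, 'e::finite) pre_digraph"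
    and w :: "real ^ 'e"
    and p :: "real ^ 'v"
  assumes "loopfree_digraph G"
    and "verts G = UNIV"
    and "arcs G = UNIV"
    and "Digraph_Component.connected G"
    and "\<And>i. 0 < w $ i"
    and "(\<Sum>v\<in>UNIV. p $ v) = 0"
  shows "(\<lambda>u. flow G u p) differentiable (at w) \<and>
    flow_weight_jacobian G p w =
      (mat 1 - diag_matrix w ** transpose (incidence_matrix G)
          ** pseudoinverse (weighted_laplacian G w) ** incidence_matrix G)
      ** diag_matrix ((transpose (incidence_matrix G) ** pseudoinverse (weighted_laplacian G w)) *v p)"
proof -
  interpret transpose_kernel_projector "incidence_matrix G" mean_matrix
    using assms(1-4) by (rule transpose_kernel_projector_incidence)
  have pinv: "pseudoinverse (weighted_laplacian G u) = L_dag u" if "\<And>i. 0 < u $ i" for u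
    using pseudoinverse_L[OF that] by (simp add: weighted_laplacian_def L_def)
  \<comment> \<open>Positive weights form a neighbourhood of \<open>w\<close>, and on it the two maps agree.\<close>
  have "\<forall>\<^sub>F u in nhds w. flow_map u p = flow G u p"
    using eventually_positive[OF assms(5)]
    by eventually_elim (simp add: flow_map_def flow_def pinv)
  then have deriv: "((\<lambda>u. flow G u p) has_derivative (*v) (flow_slope p w w)) (at w)"
    by (intro has_derivative_transform_eventually[OF flow_map_has_derivative[OF assms(5)]])
      (simp_all add: eventually_nhds_conv_at)
  then have diff: "(\<lambda>u. flow G u p) differentiable (at w)"
    by (rule differentiableI)
  have "flow_weight_jacobian G p w = matrix (frechet_derivative (\<lambda>u. flow G u p) (at w))"
    using flow_weight_jacobian_eq_jacobian[OF diff] by (simp add: jacobian_def)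
  also have "\<dots> = flow_slope p w w"
    by (simp add: frechet_derivative_at[OF deriv, symmetric])
  finally show ?thesis
    using diff by (simp only: flow_slope_def pinv[OF assms(5)])
qed

end
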